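(* Let $X,Y$ be topological spaces and let $H^*(-)$ be cohomology with coefficients in a ring $\mathscr{R}$. Then the following maps are well-defined and monotone (order-preserving): (1) $\operatorname{Im}_{H^*}:([X,Y],\leqq_L)\to(\mathcal{S}ub(H^*(X)),\leqq)$, $\operatorname{Im}_{H^*}([f]):=\operatorname{Im}(f^*:H^*(Y)\to H^*(X))$; (2) $\operatorname{Im}'_{H^*}:([X,Y]_L,\leqq'_L)\to(\mathcal{S}ub(H^*(X)),\leqq)$, $\operatorname{Im}'_{H^*}([f]_L):=\operatorname{Im}_{H^*}([f])$. Moreover $\operatorname{Im}'_{H^*}\circ\pi_L=\operatorname{Im}_{H^*}$, where $\pi_L:[X,Y]\to[X,Y]_L$ is the quotient map $[f]\mapsto[f]_L$.
   Context: $[X,Y]$ is the set of homotopy classes of continuous maps $X\to Y$. The preorder $\leqq_L$ on $[X,Y]$: $[f]\leqq_L[g]$ iff there is $[t]\in[Y,Y]$ with $[f]=[t]\circ[g]$. The equivalence relation $\sim_L$: $[f]\sim_L[g]$ iff $[f]\leqq_L[g]$ and $[g]\leqq_L[f]$; $[X,Y]_L=[X,Y]/\sim_L$, with the class of $[f]$ denoted $[f]_L$, partially ordered by $[f]_L\leqq'_L[g]_L$ iff $[f]\leqq_L[g]$. For a group $G$, $\mathcal{S}ub(G)$ is the set of all subgroups of $G$, partially ordered by inclusion ($A\leqq B$ iff $A\subseteq B$). *)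

theory Defs
  imports "HOL-Homology.Homology"
begin

section \<open>Homotopy classes of maps\<close>

text \<open>Maps \<open>X \<rightarrow> Y\<close> are total functions on the ambient type. Functions that agree on
  \<open>topspace X\<close> are identified by \<^const>\<open>homotopic_with\<close>, so the values outside
  \<open>topspace X\<close> do not matter for homotopy classes.\<close>

definition homotopy_rel :: "'a topology \<Rightarrow> 'b topology \<Rightarrow> (('a \<Rightarrow> 'b) \<times> ('a \<Rightarrow> 'b)) set" where
  "homotopy_rel X Y = {(f, g). homotopic_with (\<lambda>_. True) X Y f g}"

definition homotopy_class :: "'a topology \<Rightarrow> 'b topology \<Rightarrow> ('a \<Rightarrow> 'b) \<Rightarrow> ('a \<Rightarrow> 'b) set" where
  "homotopy_class X Y f = homotopy_rel X Y `` {f}"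

definition homotopy_classes :: "'a topology \<Rightarrow> 'b topology \<Rightarrow> ('a \<Rightarrow> 'b) set set" where
  "homotopy_classes X Y = {f. continuous_map X Y f} // homotopy_rel X Y"

definition hcomp ::
  "'a topology \<Rightarrow> 'b topology \<Rightarrow> 'c topology \<Rightarrow> ('b \<Rightarrow> 'c) set \<Rightarrow> ('a \<Rightarrow> 'b) set \<Rightarrow> ('a \<Rightarrow> 'c) set" where
  "hcomp X Y Z t b = (\<Union>s\<in>t. \<Union>g\<in>b. homotopy_class X Z (s \<circ> g))"

definition leL :: "'a topology \<Rightarrow> 'b topology \<Rightarrow> ('a \<Rightarrow> 'b) set \<Rightarrow> ('a \<Rightarrow> 'b) set \<Rightarrow> bool" where
  "leL X Y a b \<longleftrightarrow> (\<exists>t \<in> homotopy_classes Y Y. a = hcomp X Y Y t b)"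

definition simL :: "'a topology \<Rightarrow> 'b topology \<Rightarrow> (('a \<Rightarrow> 'b) set \<times> ('a \<Rightarrow> 'b) set) set" where
  "simL X Y = {(a, b). a \<in> homotopy_classes X Y \<and> b \<in> homotopy_classes X Y
                       \<and> leL X Y a b \<and> leL X Y b a}"

definition classesL :: "'a topology \<Rightarrow> 'b topology \<Rightarrow> ('a \<Rightarrow> 'b) set set set" where
  "classesL X Y = homotopy_classes X Y // simL X Y"

definition piL :: "'a topology \<Rightarrow> 'b topology \<Rightarrow> ('a \<Rightarrow> 'b) set \<Rightarrow> ('a \<Rightarrow> 'b) set set" where
  "piL X Y a = simL X Y `` {a}"

definition leL' :: "'a topology \<Rightarrow> 'b topology \<Rightarrow> ('a \<Rightarrow> 'b) set set \<Rightarrow> ('a \<Rightarrow> 'b) set set \<Rightarrow> bool" where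
  "leL' X Y A B \<longleftrightarrow> (\<exists>a\<in>A. \<exists>b\<in>B. leL X Y a b)"

section \<open>Singular cohomology with coefficients in a ring\<close>

text \<open>The \<open>p\<close>-cochains are the homomorphisms from the singular chain group to the additive group
  of \<open>R\<close>; they are made extensional so that equality of cochains is equality of functions.\<close>

definition cochain_group ::
  "('r, 'm) ring_scheme \<Rightarrow> nat \<Rightarrow> 'a topology \<Rightarrow> ('a chain \<Rightarrow> 'r) monoid" where
  "cochain_group R p X =
     \<lparr>carrier = hom (chain_group p X) (add_monoid R) \<inter> extensional (carrier (chain_group p X)),
      mult = (\<lambda>\<phi> \<psi>. \<lambda>c\<in>carrier (chain_group p X). \<phi> c \<oplus>\<^bsub>R\<^esub> \<psi> c),
      one = (\<lambda>c\<in>carrier (chain_group p X). \<zero>\<^bsub>R\<^esub>)\<rparr>"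

definition coboundary_map :: "nat \<Rightarrow> 'a topology \<Rightarrow> ('a chain \<Rightarrow> 'r) \<Rightarrow> ('a chain \<Rightarrow> 'r)" where
  "coboundary_map p X \<phi> = restrict (\<phi> \<circ> chain_boundary (Suc p)) (carrier (chain_group (Suc p) X))"

definition cocycle_group ::
  "('r, 'm) ring_scheme \<Rightarrow> nat \<Rightarrow> 'a topology \<Rightarrow> ('a chain \<Rightarrow> 'r) monoid" where
  "cocycle_group R p X =
     (cochain_group R p X)
       \<lparr>carrier := kernel (cochain_group R p X) (cochain_group R (Suc p) X) (coboundary_map p X)\<rparr>"

definition coboundaries :: "('r, 'm) ring_scheme \<Rightarrow> nat \<Rightarrow> 'a topology \<Rightarrow> ('a chain \<Rightarrow> 'r) set" where
  "coboundaries R p X =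
     (case p of 0 \<Rightarrow> {\<one>\<^bsub>cochain_group R 0 X\<^esub>}
      | Suc q \<Rightarrow> coboundary_map q X ` carrier (cochain_group R q X))"

definition cohomology_group ::
  "('r, 'm) ring_scheme \<Rightarrow> nat \<Rightarrow> 'a topology \<Rightarrow> ('a chain \<Rightarrow> 'r) set monoid" where
  "cohomology_group R p X = cocycle_group R p X Mod coboundaries R p X"

definition total_cohomology ::
  "('r, 'm) ring_scheme \<Rightarrow> 'a topology \<Rightarrow> (nat \<Rightarrow> ('a chain \<Rightarrow> 'r) set) monoid" where
  "total_cohomology R X = sum_group UNIV (\<lambda>p. cohomology_group R p X)"

definition cochain_map :: "nat \<Rightarrow> 'a topology \<Rightarrow> ('a \<Rightarrow> 'b) \<Rightarrow> ('b chain \<Rightarrow> 'r) \<Rightarrow> ('a chain \<Rightarrow> 'r)" where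
  "cochain_map p X f \<phi> = restrict (\<phi> \<circ> chain_map p f) (carrier (chain_group p X))"

text \<open>A cohomology class is a coset of cocycles, so the union below collects the classes of
  \<open>\<phi> \<circ> f\<^sub>#\<close> for all representatives \<open>\<phi>\<close>; for continuous \<open>f\<close> these are all the same coset.\<close>

definition cohom_induced ::
  "('r, 'm) ring_scheme \<Rightarrow> nat \<Rightarrow> 'a topology \<Rightarrow> ('a \<Rightarrow> 'b) \<Rightarrow> ('b chain \<Rightarrow> 'r) set \<Rightarrow> ('a chain \<Rightarrow> 'r) set"
  where
  "cohom_induced R p X f K =
     (\<Union>\<phi>\<in>K. coboundaries R p X #>\<^bsub>cocycle_group R p X\<^esub> cochain_map p X f \<phi>)"

definition total_cohom_induced ::
  "('r, 'm) ring_scheme \<Rightarrow> 'a topology \<Rightarrow> ('a \<Rightarrow> 'b) \<Rightarrow>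
   (nat \<Rightarrow> ('b chain \<Rightarrow> 'r) set) \<Rightarrow> (nat \<Rightarrow> ('a chain \<Rightarrow> 'r) set)" where
  "total_cohom_induced R X f x = (\<lambda>p. cohom_induced R p X f (x p))"

section \<open>The image maps\<close>

definition Sub :: "('g, 'm) monoid_scheme \<Rightarrow> 'g set set" where
  "Sub G = {H. subgroup H G}"

definition induced_image ::
  "('r, 'm) ring_scheme \<Rightarrow> 'a topology \<Rightarrow> 'b topology \<Rightarrow> ('a \<Rightarrow> 'b) \<Rightarrow>
   (nat \<Rightarrow> ('a chain \<Rightarrow> 'r) set) set" where
  "induced_image R X Y f = total_cohom_induced R X f ` carrier (total_cohomology R Y)"

text \<open>A function on classes is given as the common value on all representatives; that this
  value exists is the well-definedness claim.\<close>

definition Im_H ::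
  "('r, 'm) ring_scheme \<Rightarrow> 'a topology \<Rightarrow> 'b topology \<Rightarrow> ('a \<Rightarrow> 'b) set \<Rightarrow>
   (nat \<Rightarrow> ('a chain \<Rightarrow> 'r) set) set" where
  "Im_H R X Y a = the_elem (induced_image R X Y ` a)"

definition Im_H' ::
  "('r, 'm) ring_scheme \<Rightarrow> 'a topology \<Rightarrow> 'b topology \<Rightarrow> ('a \<Rightarrow> 'b) set set \<Rightarrow>
   (nat \<Rightarrow> ('a chain \<Rightarrow> 'r) set) set" where
  "Im_H' R X Y A = the_elem (Im_H R X Y ` A)"

end

theory Submission
  imports Defs
begin

text \<open>
  If \<open>[f] = [t] \<circ> [g]\<close>, then \<open>f\<^sup>* = g\<^sup>* \<circ> t\<^sup>*\<close>, and so the image of \<open>f\<^sup>*\<close> is contained in the image of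
  \<open>g\<^sup>*\<close> (\<open>induced_image_compose\<close>). This is monotonicity on homotopy classes. Two classes that are
  equivalent under \<open>\<sim>\<^sub>L\<close> lie below each other, so their images contain each other and are equal; this
  makes the map on \<open>[X,Y]\<^sub>L\<close> well defined (\<open>Im_H_simL\<close>), and its monotonicity and the identity
  with the quotient map follow. The images are subgroups because \<open>f\<^sup>*\<close> is a homomorphism in each
  degree and preserves finite support.

  The substance is that \<open>f\<^sup>*\<close> depends only on the homotopy class of \<open>f\<close>
  (\<open>homotopic_imp_cohomologous\<close>). This follows by dualizing a chain homotopy between the chain maps of
  homotopic maps (\<open>homotopic_imp_chain_homotopic\<close>). Homotopy invariance of homology does not suffice:
  it says that the chain maps agree on cycles up to boundaries, and for integral chains this gives
  no control over cochains.

  The chain homotopy is obtained by the method of acyclic models. A natural operator from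
  the \<open>p\<close>-chains of \<open>X\<close> to the \<open>(p + 1)\<close>-chains of the cylinder over \<open>X\<close> is given by a single chain in
  the cylinder over the standard \<open>p\<close>-simplex. Such chains are chosen degree by degree so that the
  prism relation holds for the identity simplex (\<open>fills_prism_0\<close>, \<open>fills_prism_Suc\<close>): what has to be
  filled is a cycle in a contractible space, hence a boundary. Naturality extends the relation to
  all spaces (\<open>chain_boundary_prism_from\<close>).
\<close>

section \<open>Chain homotopies by acyclic models\<close>

abbreviation simplex_space :: "nat \<Rightarrow> (nat \<Rightarrow> real) topology" where
  "simplex_space p \<equiv> subtopology (powertop_real UNIV) (standard_simplex p)"

abbreviation identity_simplex :: "nat \<Rightarrow> (nat \<Rightarrow> real) \<Rightarrow> nat \<Rightarrow> real" where
  "identity_simplex p \<equiv> restrict id (standard_simplex p)"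

abbreviation cylinder :: "'a topology \<Rightarrow> (real \<times> 'a) topology" where
  "cylinder X \<equiv> prod_topology (top_of_set {0..1}) X"

lemma singular_simplex_identity: "singular_simplex p (simplex_space p) (identity_simplex p)"
  unfolding singular_simplex_def
  by (metis continuous_map_eq continuous_map_id restrict_apply' restrict_extensional topspace_standard_simplex)

lemma contractible_simplex_space: "contractible_space (simplex_space p)"
proof -
  define v :: "nat \<Rightarrow> real" where "v = (\<lambda>j. if j = 0 then 1 else 0)"
  have v: "v \<in> standard_simplex p"
    by (simp add: v_def)
  let ?h = "\<lambda>(t::real, x::nat \<Rightarrow> real) i. (1 - t) * x i + t * v i"
  have c: "continuous_map (cylinder (simplex_space p)) (powertop_real UNIV) ?h"
    unfolding continuous_map_componentwise_UNIV
  proof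
    fix k
    have 1: "continuous_map (cylinder (simplex_space p)) euclideanreal fst"
      using continuous_map_fst continuous_map_into_fulltopology by blast
    have "continuous_map (simplex_space p) euclideanreal (\<lambda>x. x k)"
      by (intro continuous_map_from_subtopology continuous_map_product_projection) auto
    then have 2: "continuous_map (cylinder (simplex_space p)) euclideanreal (\<lambda>z. snd z k)"
      using continuous_map_compose[OF continuous_map_snd, unfolded o_def] by blast
    have "continuous_map (cylinder (simplex_space p)) euclideanreal
            (\<lambda>z. (1 - fst z) * snd z k + fst z * v k)"
      by (intro continuous_intros 1 2)
    then show "continuous_map (cylinder (simplex_space p)) euclideanreal (\<lambda>z. ?h z k)"
      by (simp add: case_prod_unfold)
  qed
  moreover have "?h z \<in> standard_simplex p" if "z \<in> topspace (cylinder (simplex_space p))" for z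
    using that v by (auto intro!: convex_standard_simplex)
  ultimately have "continuous_map (cylinder (simplex_space p)) (simplex_space p) ?h"
    by (auto simp: continuous_map_in_subtopology)
  then have "homotopic_with (\<lambda>_. True) (simplex_space p) (simplex_space p) id (\<lambda>_. v)"
    unfolding homotopic_with_def by (intro exI[of _ ?h]) auto
  then show ?thesis
    by (auto simp: contractible_space_def)
qed

lemma contractible_cylinder:
  assumes "contractible_space X"
  shows "contractible_space (cylinder X)"
proof -
  have "contractible_space (top_of_set {0..1::real})"
    unfolding contractible_space_top_of_set
    by (rule convex_imp_contractible) (rule convex_real_interval)
  with assms show ?thesis
    unfolding contractible_space_prod_topology by blast
qed

text \<open>A null-homotopy moves a cycle, up to a boundary, into a one-point subspace, and there every
  cycle of positive degree is a boundary.\<close>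

lemma contractible_imp_boundary:
  assumes X: "contractible_space X" and c: "singular_relcycle p X {} c" and p: "p \<noteq> 0"
  shows "singular_relboundary p X {} c"
proof -
  obtain a where a: "homotopic_with (\<lambda>x. True) X X id (\<lambda>x. a)"
    using X by (auto simp: contractible_space_def)
  show ?thesis
  proof (cases "topspace X = {}")
    case True
    then show ?thesis
      using c by (simp add: singular_relcycle_def singular_chain_empty)
  next
    case False
    then have aX: "a \<in> topspace X"
      using homotopic_with_imp_continuous_maps[OF a] by (auto simp: continuous_map_def)
    let ?A = "subtopology X {a}"
    have A: "topspace ?A = {a}"
      using aX by auto
    have "homologous_rel p X {} (chain_map p id c) (chain_map p (\<lambda>x. a) c)"
      by (rule homotopic_imp_homologous_rel_chain_maps[OF _ c]) (use a in \<open>simp\<close>)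
    then have *: "homologous_rel p X {} c (chain_map p (\<lambda>x. a) c)"
      using c by (metis chain_map_ident singular_relcycle)
    have "singular_relcycle p ?A {} (chain_map p (\<lambda>x. a) c)"
      by (rule singular_relcycle_chain_map[OF c]) (use aX in auto)
    then have "singular_relboundary p ?A {} (chain_map p (\<lambda>x. a) c)"
      using singular_boundary_eq_cycle_singleton[OF A] p by auto
    then have "singular_relboundary p X {} (chain_map p (\<lambda>x. a) c)"
      using singular_boundary_mono[of "{a}" "topspace X" p X] aX by simp
    with * show ?thesis
      by (metis homologous_rel_def singular_relboundary_add diff_add_cancel)
  qed
qed

text \<open>A chain \<open>d\<close> of degree \<open>p + 1\<close> in the cylinder over the standard \<open>p\<close>-simplex is a template: each
  simplex \<open>\<sigma>\<close> of \<open>X\<close> carries it into the cylinder over \<open>X\<close> by \<open>id \<times> \<sigma>\<close>. Every additive operator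
  that is natural in \<open>X\<close> has this form, since it is determined by its value on the identity simplex.\<close>

definition prism_from ::
  "nat \<Rightarrow> (real \<times> (nat \<Rightarrow> real)) chain \<Rightarrow> 'a chain \<Rightarrow> (real \<times> 'a) chain" where
  "prism_from p d = frag_extend (\<lambda>\<sigma>. chain_map (Suc p) (map_prod id \<sigma>) d)"

lemma prism_from_0 [simp]: "prism_from p d 0 = 0"
  by (simp add: prism_from_def)

lemma prism_from_diff: "prism_from p d (a - b) = prism_from p d a - prism_from p d b"
  by (simp add: prism_from_def frag_extend_diff)

lemma prism_from_add: "prism_from p d (a + b) = prism_from p d a + prism_from p d b"
  by (simp add: prism_from_def frag_extend_add)

lemma continuous_map_cylinder:
  "continuous_map X Y f \<Longrightarrow> continuous_map (cylinder X) (cylinder Y) (map_prod id f)"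
  unfolding map_prod_def id_def
  by (simp add: continuous_map_prod_top)

lemma continuous_map_cylinder_end:
  "t \<in> {0..1} \<Longrightarrow> continuous_map X (cylinder X) (Pair t)"
  by (simp add: continuous_map_pairwise o_def)

lemma singular_chain_prism_from:
  assumes d: "singular_chain (Suc p) (cylinder (simplex_space p)) d"
    and c: "singular_chain p X c"
  shows "singular_chain (Suc p) (cylinder X) (prism_from p d c)"
  unfolding prism_from_def
proof (rule singular_chain_extend)
  fix \<sigma> assume "\<sigma> \<in> Poly_Mapping.keys c"
  then have "continuous_map (simplex_space p) X \<sigma>"
    using c by (auto simp: singular_chain_def singular_simplex_def)
  then show "singular_chain (Suc p) (cylinder X) (chain_map (Suc p) (map_prod id \<sigma>) d)"
    by (intro singular_chain_chain_map[OF d] continuous_map_cylinder)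
qed

text \<open>Naturality. The simplex \<open>f \<circ> \<sigma>\<close> is cut off outside the standard simplex, so the two sides
  use maps that agree only on the cylinder over the standard simplex, which is where \<open>d\<close> lives.\<close>

lemma prism_from_chain_map:
  assumes d: "singular_chain (Suc p) (cylinder (simplex_space p)) d"
  shows "prism_from p d (chain_map p f c) = chain_map (Suc p) (map_prod id f) (prism_from p d c)"
  using subset_UNIV
proof (induction c rule: frag_induction)
  case (one \<sigma>)
  have "chain_map (Suc p) (map_prod id (simplex_map p f \<sigma>)) d
        = chain_map (Suc p) (map_prod id f \<circ> map_prod id \<sigma>) d"
    by (rule chain_map_eq[OF d]) (auto simp: simplex_map_def)
  then show ?case
    by (simp only: prism_from_def chain_map_compose chain_map_of frag_extend_of o_apply)
next
  case (diff a b)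
  then show ?case
    by (simp add: prism_from_diff chain_map_diff)
qed simp

text \<open>The prism relation, required only of the identity simplex of the standard \<open>p\<close>-simplex: the
  boundary of \<open>d\<close> is top minus bottom minus the sides, and the sides are built from the template \<open>e\<close>
  of the degree below. In degree \<open>0\<close> there are no sides, and since \<open>p - 1\<close> is then \<open>0\<close> as well, the
  degree condition on \<open>e\<close> is imposed only for \<open>p \<noteq> 0\<close>.\<close>

definition fills_prism ::
  "nat \<Rightarrow> (real \<times> (nat \<Rightarrow> real)) chain \<Rightarrow> (real \<times> (nat \<Rightarrow> real)) chain \<Rightarrow> bool" where
  "fills_prism p e d \<longleftrightarrow>
     (p \<noteq> 0 \<longrightarrow> singular_chain p (cylinder (simplex_space (p - 1))) e) \<and>
     singular_chain (Suc p) (cylinder (simplex_space p)) d \<and>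
     (let \<iota> = frag_of (identity_simplex p) in
      chain_boundary (Suc p) d =
        chain_map p (Pair 1) \<iota> - chain_map p (Pair 0) \<iota>
        - prism_from (p - 1) e (chain_boundary p \<iota>))"

text \<open>Naturality carries the prism relation from the identity simplex to every chain of every space.\<close>

lemma chain_boundary_prism_from:
  assumes d: "fills_prism p e d" and c: "singular_chain p X c"
  shows "chain_boundary (Suc p) (prism_from p d c) =
           chain_map p (Pair 1) c - chain_map p (Pair 0) c - prism_from (p - 1) e (chain_boundary p c)"
  using c unfolding singular_chain_def
proof (induction c rule: frag_induction)
  case (one \<sigma>)
  let ?\<iota> = "frag_of (identity_simplex p)"
  let ?F = "\<lambda>p. chain_map p (map_prod id \<sigma>)"
  have \<sigma>: "singular_simplex p X \<sigma>"
    using one by simp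
  have \<iota>: "singular_chain p (simplex_space p) ?\<iota>"
    by (simp add: singular_chain_of singular_simplex_identity)
  have ends: "?F p (chain_map p (Pair t) ?\<iota>) = chain_map p (Pair t) (frag_of \<sigma>)" for t :: real
  proof -
    have "?F p (chain_map p (Pair t) ?\<iota>) = chain_map p (map_prod id \<sigma> \<circ> Pair t) ?\<iota>"
      by (simp only: chain_map_compose o_apply)
    also have "map_prod id \<sigma> \<circ> Pair t = Pair t \<circ> \<sigma>"
      by auto
    also have "chain_map p (Pair t \<circ> \<sigma>) ?\<iota> = chain_map p (Pair t) (chain_map p \<sigma> ?\<iota>)"
      by (simp only: chain_map_compose o_apply)
    finally show ?thesis
      by (simp only: singular_simplex_chain_map_id[OF \<sigma>])
  qed
  have sides: "?F p (prism_from (p - 1) e (chain_boundary p ?\<iota>))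
               = prism_from (p - 1) e (chain_boundary p (frag_of \<sigma>))"
  proof (cases "p = 0")
    case True
    then show ?thesis
      by (simp add: chain_boundary_def)
  next
    case False
    then have "singular_chain (Suc (p - 1)) (cylinder (simplex_space (p - 1))) e"
      using d by (simp add: fills_prism_def)
    from prism_from_chain_map[OF this, of \<sigma> "chain_boundary p ?\<iota>"] False
    have "?F p (prism_from (p - 1) e (chain_boundary p ?\<iota>))
          = prism_from (p - 1) e (chain_map (p - 1) \<sigma> (chain_boundary p ?\<iota>))"
      by simp
    then show ?thesis
      using chain_boundary_chain_map[OF \<iota>, of \<sigma>] singular_simplex_chain_map_id[OF \<sigma>] by simp
  qed
  have "chain_boundary (Suc p) (prism_from p d (frag_of \<sigma>)) = ?F p (chain_boundary (Suc p) d)"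
    using d chain_boundary_chain_map by (fastforce simp: prism_from_def fills_prism_def)
  also have "\<dots> = chain_map p (Pair 1) (frag_of \<sigma>) - chain_map p (Pair 0) (frag_of \<sigma>)
                  - prism_from (p - 1) e (chain_boundary p (frag_of \<sigma>))"
    using d by (simp only: fills_prism_def Let_def chain_map_diff ends sides)
  finally show ?case .
next
  case (diff a b)
  then show ?case
    by (simp add: prism_from_diff chain_boundary_diff chain_map_diff)
qed (simp_all)

text \<open>Sliding along the cylinder is a homotopy from its bottom inclusion to its top inclusion, so
  homotopy invariance of homology, applied to the \<open>0\<close>-cycle given by the identity simplex, yields a
  chain between the two end points.\<close>

lemma fills_prism_0: "\<exists>d. fills_prism 0 e d"
proof -
  let ?S = "simplex_space 0" and ?\<iota> = "frag_of (identity_simplex 0)"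
  have "homotopic_with (\<lambda>_. True) ?S (cylinder ?S) (Pair 1) (Pair 0)"
  proof (rule homotopic_with_symD)
    show "homotopic_with (\<lambda>_. True) ?S (cylinder ?S) (Pair 0) (Pair 1)"
      unfolding homotopic_with_def by (intro exI[of _ id]) auto
  qed
  moreover have "singular_relcycle 0 ?S {} ?\<iota>"
    by (simp add: singular_cycle singular_chain_of singular_simplex_identity chain_boundary_def)
  ultimately have "homologous_rel 0 (cylinder ?S) {} (chain_map 0 (Pair 1) ?\<iota>) (chain_map 0 (Pair 0) ?\<iota>)"
    by (intro homotopic_imp_homologous_rel_chain_maps) auto
  then show ?thesis
    by (auto simp: homologous_rel_def singular_boundary fills_prism_def Let_def chain_boundary_def
        simp del: chain_map_of)
qed

text \<open>The part of the boundary that the new template must fill is a cycle, by the prism relation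
  one degree below, and the cylinder over a simplex is contractible, so the cycle bounds.\<close>

lemma fills_prism_Suc:
  assumes d: "fills_prism p e d"
  shows "\<exists>d'. fills_prism (Suc p) d d'"
proof -
  let ?S = "simplex_space (Suc p)" and ?\<iota> = "frag_of (identity_simplex (Suc p))"
  let ?z = "chain_map (Suc p) (Pair 1) ?\<iota> - chain_map (Suc p) (Pair 0) ?\<iota>
            - prism_from p d (chain_boundary (Suc p) ?\<iota>)"
  have dch: "singular_chain (Suc p) (cylinder (simplex_space p)) d"
    using d by (simp add: fills_prism_def)
  have \<iota>: "singular_chain (Suc p) ?S ?\<iota>"
    by (simp add: singular_chain_of singular_simplex_identity)
  have b\<iota>: "singular_chain p ?S (chain_boundary (Suc p) ?\<iota>)"
    by (rule singular_chain_boundary_alt[OF \<iota>])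
  have "singular_chain (Suc p) (cylinder ?S) ?z"
    by (intro singular_chain_diff singular_chain_prism_from[OF dch b\<iota>]
        singular_chain_chain_map[OF \<iota>] continuous_map_cylinder_end) auto
  moreover have "chain_boundary (Suc p) ?z = 0"
    using chain_boundary_boundary_alt[OF \<iota>]
    by (simp add: chain_boundary_diff chain_boundary_chain_map[OF \<iota>]
        chain_boundary_prism_from[OF d b\<iota>] del: chain_map_of)
  ultimately have "singular_relboundary (Suc p) (cylinder ?S) {} ?z"
    by (intro contractible_imp_boundary contractible_cylinder contractible_simplex_space)
       (simp_all add: singular_cycle)
  then show ?thesis
    using dch by (auto simp: singular_boundary fills_prism_def Let_def simp del: chain_map_of)
qed

lemma prism_fillers_exist:
  obtains D where "\<And>p. fills_prism p (D (p - 1)) (D p)"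
proof -
  obtain D where D: "\<And>p. \<exists>e. fills_prism p e (D p)" "\<And>p. fills_prism (Suc p) (D p) (D (Suc p))"
    using dependent_nat_choice[of "\<lambda>p d. \<exists>e. fills_prism p e d" "\<lambda>p d d'. fills_prism (Suc p) d d'"]
      fills_prism_0 fills_prism_Suc by metis
  have "fills_prism p (D (p - 1)) (D p)" for p
  proof (cases p)
    \<comment> \<open>Here \<open>D 0\<close> stands in for its own predecessor, but it is only applied to the boundary of
      a \<open>0\<close>-simplex, which is \<open>0\<close>.\<close>
    case 0
    then show ?thesis
      using D(1)[of 0] by (auto simp: fills_prism_def chain_boundary_def)
  next
    case (Suc q)
    then show ?thesis
      using D(2) by simp
  qed
  then show thesis
    by (rule that)
qed

text \<open>Invariance of homology compares the chain maps of \<open>f\<close> and \<open>g\<close> on cycles only. Cochains are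
  evaluated on all chains, so cohomology needs the chain homotopy itself. It is the natural prism
  operator into the cylinder over \<open>X\<close> followed by the homotopy.\<close>

theorem homotopic_imp_chain_homotopic:
  assumes "homotopic_with (\<lambda>_. True) X Y f g"
  obtains K where
    "\<And>p c. singular_chain p X c \<Longrightarrow> singular_chain (Suc p) Y (K p c)"
    "\<And>p a b. K p (a + b) = K p a + K p b"
    "\<And>p c. singular_chain p X c \<Longrightarrow>
       chain_boundary (Suc p) (K p c) =
         chain_map p g c - chain_map p f c - K (p - 1) (chain_boundary p c)"
proof -
  obtain h where h: "continuous_map (cylinder X) Y h"
    and h0: "\<And>x. h (0, x) = f x" and h1: "\<And>x. h (1, x) = g x"
    using assms by (auto simp: homotopic_with_def)
  obtain D where D: "\<And>p. fills_prism p (D (p - 1)) (D p)"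
    using prism_fillers_exist by blast
  have Dch: "singular_chain (Suc p) (cylinder (simplex_space p)) (D p)" for p
    using D by (simp add: fills_prism_def)
  define K where "K p c = chain_map (Suc p) h (prism_from p (D p) c)" for p c
  show thesis
  proof
    show "singular_chain (Suc p) Y (K p c)" if "singular_chain p X c" for p c
      unfolding K_def
      by (intro singular_chain_chain_map[OF _ h] singular_chain_prism_from[OF Dch that])
    show "K p (a + b) = K p a + K p b" for p a b
      by (simp add: K_def prism_from_add chain_map_add)
    show "chain_boundary (Suc p) (K p c) =
         chain_map p g c - chain_map p f c - K (p - 1) (chain_boundary p c)"
      if c: "singular_chain p X c" for p c
    proof -
      have ends: "chain_map p h (chain_map p (Pair t) c) = chain_map p (\<lambda>x. h (t, x)) c" for t
        using chain_map_compose[of p h "Pair t"] by (simp add: o_def fun_eq_iff)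
      have "chain_boundary (Suc p) (K p c)
            = chain_map p h (chain_boundary (Suc p) (prism_from p (D p) c))"
        using chain_boundary_chain_map[OF singular_chain_prism_from[OF Dch c], of h]
        by (simp add: K_def)
      moreover have "chain_map p h (prism_from (p - 1) (D (p - 1)) (chain_boundary p c))
                     = K (p - 1) (chain_boundary p c)"
        by (cases p) (simp_all add: K_def chain_boundary_def)
      ultimately show ?thesis
        by (simp add: chain_boundary_prism_from[OF D c] chain_map_diff ends h0 h1)
    qed
  qed
qed

section \<open>Homomorphisms of quotient groups and direct sums\<close>

lemma subgroup_comm_group:
  assumes "comm_group G" "subgroup H G"
  shows "comm_group (G\<lparr>carrier := H\<rparr>)"
proof -
  interpret G: comm_group G by fact
  interpret H: group "G\<lparr>carrier := H\<rparr>"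
    using assms(2) G.is_group by (rule subgroup.subgroup_is_group)
  show ?thesis
    by (rule H.group_comm_groupI) (use subgroup.subset[OF assms(2)] G.m_comm in auto)
qed

text \<open>The union that defines the induced map on classes is over equal cosets: representatives of the
  same class differ by an element of \<open>N\<close>, which \<open>h\<close> sends into \<open>M\<close>.\<close>

lemma coset_union_eq:
  assumes h: "h \<in> hom G H" and N: "N \<lhd> G" and M: "M \<lhd> H" and NM: "h ` N \<subseteq> M"
    and a: "a \<in> carrier G"
  shows "(\<Union>x\<in>N #>\<^bsub>G\<^esub> a. M #>\<^bsub>H\<^esub> h x) = M #>\<^bsub>H\<^esub> h a"
proof -
  interpret N: normal N G by fact
  interpret M: normal M H by fact
  have ha: "h a \<in> carrier H"
    using h a by (rule hom_in_carrier)
  have eq: "M #>\<^bsub>H\<^esub> h x = M #>\<^bsub>H\<^esub> h a" if x: "x \<in> N #>\<^bsub>G\<^esub> a" for x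
  proof -
    obtain n where n: "n \<in> N" "x = n \<otimes>\<^bsub>G\<^esub> a"
      using x by (auto simp: r_coset_def)
    then have "h x = h n \<otimes>\<^bsub>H\<^esub> h a"
      using a N.subset by (auto intro: hom_mult[OF h])
    then have "h x \<in> M #>\<^bsub>H\<^esub> h a"
      using n NM by (auto simp: r_coset_def)
    then show ?thesis
      using M.repr_independence[OF _ ha M.subgroup_axioms] by simp
  qed
  moreover have "a \<in> N #>\<^bsub>G\<^esub> a"
    by (rule N.rcos_self[OF a N.subgroup_axioms])
  ultimately show ?thesis
    by blast
qed

lemma coset_union_hom:
  assumes h: "h \<in> hom G H" and N: "N \<lhd> G" and M: "M \<lhd> H" and NM: "h ` N \<subseteq> M"
  shows "(\<lambda>K. \<Union>x\<in>K. M #>\<^bsub>H\<^esub> h x) \<in> hom (G Mod N) (H Mod M)"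
proof (rule homI)
  interpret N: normal N G by fact
  interpret M: normal M H by fact
  note eq = coset_union_eq[OF h N M NM]
  fix K assume K: "K \<in> carrier (G Mod N)"
  then obtain a where a: "a \<in> carrier G" "K = N #>\<^bsub>G\<^esub> a"
    by (auto simp: carrier_FactGroup)
  then show "(\<Union>x\<in>K. M #>\<^bsub>H\<^esub> h x) \<in> carrier (H Mod M)"
    using hom_in_carrier[OF h] by (simp add: eq carrier_FactGroup)
  fix L assume L: "L \<in> carrier (G Mod N)"
  then obtain b where b: "b \<in> carrier G" "L = N #>\<^bsub>G\<^esub> b"
    by (auto simp: carrier_FactGroup)
  show "(\<Union>x\<in>K \<otimes>\<^bsub>G Mod N\<^esub> L. M #>\<^bsub>H\<^esub> h x)
        = (\<Union>x\<in>K. M #>\<^bsub>H\<^esub> h x) \<otimes>\<^bsub>H Mod M\<^esub> (\<Union>x\<in>L. M #>\<^bsub>H\<^esub> h x)"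
    using a b hom_in_carrier[OF h] by (simp add: N.rcos_sum M.rcos_sum eq hom_mult[OF h])
qed

lemma sum_group_hom:
  assumes G: "\<And>i. i \<in> I \<Longrightarrow> group (G i)" and H: "\<And>i. i \<in> I \<Longrightarrow> group (H i)"
    and h: "\<And>i. i \<in> I \<Longrightarrow> h i \<in> hom (G i) (H i)"
  shows "(\<lambda>x. \<lambda>i\<in>I. h i (x i)) \<in> hom (sum_group I G) (sum_group I H)"
proof (rule homI)
  fix x assume x: "x \<in> carrier (sum_group I G)"
  \<comment> \<open>Homomorphisms preserve the neutral element, so the support does not grow.\<close>
  have "{i \<in> I. h i (x i) \<noteq> \<one>\<^bsub>H i\<^esub>} \<subseteq> {i \<in> I. x i \<noteq> \<one>\<^bsub>G i\<^esub>}"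
    using hom_one[OF h G H] by auto
  with x show "(\<lambda>i\<in>I. h i (x i)) \<in> carrier (sum_group I H)"
    by (auto simp: carrier_sum_group G H PiE_iff intro: hom_in_carrier[OF h] finite_subset
        cong: conj_cong)
  fix y assume y: "y \<in> carrier (sum_group I G)"
  show "(\<lambda>i\<in>I. h i ((x \<otimes>\<^bsub>sum_group I G\<^esub> y) i))
        = (\<lambda>i\<in>I. h i (x i)) \<otimes>\<^bsub>sum_group I H\<^esub> (\<lambda>i\<in>I. h i (y i))"
    using x y by (auto simp: carrier_sum_group G PiE_iff hom_mult[OF h])
qed

section \<open>Singular cohomology as a homotopy functor\<close>

lemma mem_cochain_group:
  "\<phi> \<in> carrier (cochain_group R p X) \<longleftrightarrow>
     \<phi> \<in> extensional (singular_chain_set p X) \<and>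
     (\<forall>c. singular_chain p X c \<longrightarrow> \<phi> c \<in> carrier R) \<and>
     (\<forall>c d. singular_chain p X c \<longrightarrow> singular_chain p X d \<longrightarrow> \<phi> (c + d) = \<phi> c \<oplus>\<^bsub>R\<^esub> \<phi> d)"
  by (auto simp: cochain_group_def hom_def)

lemma mult_cochain_group [simp]:
  "\<phi> \<otimes>\<^bsub>cochain_group R p X\<^esub> \<psi> = (\<lambda>c\<in>singular_chain_set p X. \<phi> c \<oplus>\<^bsub>R\<^esub> \<psi> c)"
  by (simp add: cochain_group_def)

lemma one_cochain_group [simp]:
  "\<one>\<^bsub>cochain_group R p X\<^esub> = (\<lambda>c\<in>singular_chain_set p X. \<zero>\<^bsub>R\<^esub>)"
  by (simp add: cochain_group_def)

lemma mult_cocycle_group [simp]: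
  "monoid.mult (cocycle_group R p X) = monoid.mult (cochain_group R p X)"
  by (simp add: cocycle_group_def)

lemma one_cocycle_group [simp]:
  "\<one>\<^bsub>cocycle_group R p X\<^esub> = \<one>\<^bsub>cochain_group R p X\<^esub>"
  by (simp add: cocycle_group_def)

lemma chain_map_chain_boundary:
  "singular_chain (Suc p) X c \<Longrightarrow>
     chain_map p f (chain_boundary (Suc p) c) = chain_boundary (Suc p) (chain_map (Suc p) f c)"
  by (simp add: chain_boundary_chain_map)

lemma coboundary_map_apply:
  "singular_chain (Suc p) X c \<Longrightarrow> coboundary_map p X \<phi> c = \<phi> (chain_boundary (Suc p) c)"
  by (simp add: coboundary_map_def)

text \<open>Vanishing on boundaries is the form in which a cocycle meets a chain homotopy.\<close>

lemma mem_cocycle_group: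
  "\<phi> \<in> carrier (cocycle_group R p X) \<longleftrightarrow>
     \<phi> \<in> carrier (cochain_group R p X) \<and>
     (\<forall>c. singular_chain (Suc p) X c \<longrightarrow> \<phi> (chain_boundary (Suc p) c) = \<zero>\<^bsub>R\<^esub>)"
  by (auto simp: cocycle_group_def kernel_def coboundary_map_def fun_eq_iff restrict_def)

text \<open>Cochains take values in the additive group of the coefficients; here \<open>G\<close> is any abelian group
  in the ring signature, and its addition is written \<open>\<oplus>\<close>.\<close>

context abelian_group
begin

lemma comm_group_cochain_group: "comm_group (cochain_group G p X)"
proof (rule comm_groupI)
  fix \<phi> assume \<phi>: "\<phi> \<in> carrier (cochain_group G p X)"
  then have "(\<lambda>c\<in>singular_chain_set p X. \<ominus> \<phi> c) \<in> carrier (cochain_group G p X)"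
    by (auto simp: mem_cochain_group singular_chain_add minus_add a_comm)
  moreover have "(\<lambda>c\<in>singular_chain_set p X. \<ominus> \<phi> c) \<otimes>\<^bsub>cochain_group G p X\<^esub> \<phi>
                 = \<one>\<^bsub>cochain_group G p X\<^esub>"
    using \<phi> by (auto simp: mem_cochain_group l_neg)
  ultimately show "\<exists>\<psi>\<in>carrier (cochain_group G p X). \<psi> \<otimes>\<^bsub>cochain_group G p X\<^esub> \<phi> = \<one>\<^bsub>cochain_group G p X\<^esub>"
    by blast
qed (auto simp: mem_cochain_group singular_chain_add a_ac extensional_def)

lemma cochain_zero:
  assumes "\<phi> \<in> carrier (cochain_group G p X)"
  shows "\<phi> 0 = \<zero>"
proof -
  have "\<phi> 0 \<in> carrier G" "\<phi> 0 \<oplus> \<phi> 0 = \<phi> 0"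
    using assms unfolding mem_cochain_group by (metis add_0 singular_chain_0)+
  then show ?thesis
    by (metis add.l_cancel_one')
qed

lemma coboundary_map_hom:
  "coboundary_map p X \<in> hom (cochain_group G p X) (cochain_group G (Suc p) X)"
  by (rule homI)
     (auto simp: mem_cochain_group coboundary_map_def singular_chain_boundary_alt
       singular_chain_add chain_boundary_add)

lemma coboundary_map_into_cocycles:
  assumes "\<phi> \<in> carrier (cochain_group G p X)"
  shows "coboundary_map p X \<phi> \<in> carrier (cocycle_group G (Suc p) X)"
  using hom_in_carrier[OF coboundary_map_hom assms]
  by (auto simp: mem_cocycle_group coboundary_map_apply singular_chain_boundary_alt
      chain_boundary_boundary_alt cochain_zero[OF assms])

lemma comm_group_cocycle_group: "comm_group (cocycle_group G p X)"
proof -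
  interpret C: comm_group "cochain_group G p X"
    by (rule comm_group_cochain_group)
  interpret C': comm_group "cochain_group G (Suc p) X"
    by (rule comm_group_cochain_group)
  interpret group_hom "cochain_group G p X" "cochain_group G (Suc p) X" "coboundary_map p X"
    by unfold_locales (rule coboundary_map_hom)
  show ?thesis
    unfolding cocycle_group_def
    by (rule subgroup_comm_group[OF comm_group_cochain_group subgroup_kernel])
qed

lemma normal_coboundaries: "coboundaries G p X \<lhd> cocycle_group G p X"
proof -
  interpret Z: comm_group "cocycle_group G p X"
    by (rule comm_group_cocycle_group)
  have "subgroup (coboundaries G p X) (cocycle_group G p X)"
  proof (cases p)
    case 0
    then show ?thesis
      using Z.triv_subgroup by (simp add: coboundaries_def)
  next
    case (Suc q)
    interpret C: comm_group "cochain_group G q X"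
      by (rule comm_group_cochain_group)
    interpret group_hom "cochain_group G q X" "cocycle_group G p X" "coboundary_map q X"
    proof unfold_locales
      show "coboundary_map q X \<in> hom (cochain_group G q X) (cocycle_group G p X)"
        using coboundary_map_hom[of q X] coboundary_map_into_cocycles[of _ q X]
        by (auto simp: hom_def Suc)
    qed
    show ?thesis
      using img_is_subgroup by (simp add: coboundaries_def Suc)
  qed
  then show ?thesis
    by (rule Z.subgroup_imp_normal)
qed

lemma group_cohomology_group: "group (cohomology_group G p X)"
  unfolding cohomology_group_def by (rule normal.factorgroup_is_group[OF normal_coboundaries])

lemma coset_subset_cocycles:
  assumes "K \<in> carrier (cohomology_group G p X)"
  shows "K \<subseteq> carrier (cocycle_group G p X)"
proof -
  interpret normal "coboundaries G p X" "cocycle_group G p X"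
    by (rule normal_coboundaries)
  show ?thesis
    using assms by (auto simp: cohomology_group_def carrier_FactGroup dest: r_coset_subset_G[OF subset])
qed

lemma cochain_map_hom:
  assumes "continuous_map X Y f"
  shows "cochain_map p X f \<in> hom (cocycle_group G p Y) (cocycle_group G p X)"
  by (rule homI)
     (use assms in \<open>auto simp: mem_cocycle_group mem_cochain_group cochain_map_def
       singular_chain_chain_map singular_chain_add chain_map_add singular_chain_boundary_alt
       chain_map_chain_boundary\<close>)

lemma cochain_map_coboundaries:
  assumes f: "continuous_map X Y f"
  shows "cochain_map p X f ` coboundaries G p Y \<subseteq> coboundaries G p X"
proof (cases p)
  case 0
  have "cochain_map 0 X f \<one>\<^bsub>cochain_group G 0 Y\<^esub> = \<one>\<^bsub>cochain_group G 0 X\<^esub>"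
    using f by (auto simp: cochain_map_def singular_chain_chain_map)
  then show ?thesis
    by (simp add: coboundaries_def 0)
next
  case (Suc q)
  have "cochain_map p X f (coboundary_map q Y \<phi>) = coboundary_map q X (cochain_map q X f \<phi>)" for \<phi>
    using f by (auto simp: Suc cochain_map_def coboundary_map_def singular_chain_chain_map
        singular_chain_boundary_alt chain_map_chain_boundary)
  moreover have "cochain_map q X f \<phi> \<in> carrier (cochain_group G q X)"
    if "\<phi> \<in> carrier (cochain_group G q Y)" for \<phi>
    using that f by (auto simp: mem_cochain_group cochain_map_def singular_chain_chain_map
        singular_chain_add chain_map_add)
  ultimately show ?thesis
    by (auto simp: coboundaries_def Suc)
qed

lemma cohom_induced_coset:
  assumes "continuous_map X Y f" "\<phi> \<in> carrier (cocycle_group G p Y)"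
  shows "cohom_induced G p X f (coboundaries G p Y #>\<^bsub>cocycle_group G p Y\<^esub> \<phi>)
         = coboundaries G p X #>\<^bsub>cocycle_group G p X\<^esub> cochain_map p X f \<phi>"
  unfolding cohom_induced_def
  by (rule coset_union_eq[OF cochain_map_hom normal_coboundaries normal_coboundaries
        cochain_map_coboundaries]) (use assms in auto)

lemma cohom_induced_hom:
  assumes "continuous_map X Y f"
  shows "cohom_induced G p X f \<in> hom (cohomology_group G p Y) (cohomology_group G p X)"
  unfolding cohom_induced_def[abs_def] cohomology_group_def
  by (rule coset_union_hom[OF cochain_map_hom normal_coboundaries normal_coboundaries
        cochain_map_coboundaries]) (use assms in auto)

lemma cohom_induced_compose:
  assumes g: "continuous_map X Y g" and s: "continuous_map Y Z s"
    and K: "K \<in> carrier (cohomology_group G p Z)"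
  shows "cohom_induced G p X (s \<circ> g) K = cohom_induced G p X g (cohom_induced G p Y s K)"
proof -
  obtain \<phi> where \<phi>: "\<phi> \<in> carrier (cocycle_group G p Z)"
    "K = coboundaries G p Z #>\<^bsub>cocycle_group G p Z\<^esub> \<phi>"
    using K by (auto simp: cohomology_group_def carrier_FactGroup)
  have "cochain_map p X (s \<circ> g) \<phi> = cochain_map p X g (cochain_map p Y s \<phi>)"
    using g by (auto simp: cochain_map_def singular_chain_chain_map chain_map_compose)
  then show ?thesis
    using \<phi> hom_in_carrier[OF cochain_map_hom[OF s] \<phi>(1)]
    by (simp add: cohom_induced_coset continuous_map_compose[OF g s] g s)
qed

text \<open>Let \<open>K\<close> be a chain homotopy from \<open>f\<close> to \<open>g\<close>. A cocycle \<open>\<phi>\<close> vanishes on the boundary of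
  \<open>K c\<close>, so its pullbacks along \<open>g\<close> and \<open>f\<close> differ at \<open>c\<close> by \<open>\<phi> (K (\<partial> c))\<close>, which is the value at
  \<open>c\<close> of the coboundary of \<open>\<phi> \<circ> K\<close>.\<close>

lemma homotopic_imp_cohomologous:
  assumes hom: "homotopic_with (\<lambda>_. True) X Y f g"
    and \<phi>: "\<phi> \<in> carrier (cocycle_group G p Y)"
  shows "coboundaries G p X #>\<^bsub>cocycle_group G p X\<^esub> cochain_map p X f \<phi>
         = coboundaries G p X #>\<^bsub>cocycle_group G p X\<^esub> cochain_map p X g \<phi>"
proof -
  obtain K where Kch: "\<And>p c. singular_chain p X c \<Longrightarrow> singular_chain (Suc p) Y (K p c)"
    and Kadd: "\<And>p a b. K p (a + b) = K p a + K p b"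
    and K: "\<And>p c. singular_chain p X c \<Longrightarrow>
       chain_boundary (Suc p) (K p c) =
         chain_map p g c - chain_map p f c - K (p - 1) (chain_boundary p c)"
    using homotopic_imp_chain_homotopic[OF hom] by metis
  have f: "continuous_map X Y f" and g: "continuous_map X Y g"
    using homotopic_with_imp_continuous_maps[OF hom] by auto
  have \<phi>C: "\<phi> \<in> carrier (cochain_group G p Y)"
    and \<phi>b: "\<And>c. singular_chain (Suc p) Y c \<Longrightarrow> \<phi> (chain_boundary (Suc p) c) = \<zero>"
    using \<phi> by (auto simp: mem_cocycle_group)
  have \<phi>R: "\<And>c. singular_chain p Y c \<Longrightarrow> \<phi> c \<in> carrier G"
    and \<phi>add: "\<And>c d. singular_chain p Y c \<Longrightarrow> singular_chain p Y d \<Longrightarrow> \<phi> (c + d) = \<phi> c \<oplus> \<phi> d"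
    using \<phi>C by (auto simp: mem_cochain_group)
  have K0: "K q 0 = 0" for q
    using Kadd[of q 0 0] by simp
  have diff: "\<phi> (chain_map p g c) = \<phi> (K (p - 1) (chain_boundary p c)) \<oplus> \<phi> (chain_map p f c)"
    if c: "singular_chain p X c" for c
  proof -
    let ?a = "chain_boundary (Suc p) (K p c)" and ?b = "K (p - 1) (chain_boundary p c)"
    have a: "singular_chain p Y ?a"
      using singular_chain_boundary_alt Kch c by blast
    have b: "singular_chain p Y ?b"
    proof (cases p)
      case (Suc q)
      then show ?thesis
        using Kch[OF singular_chain_boundary_alt, of q c] c by simp
    qed (simp add: chain_boundary_def K0)
    have fc: "singular_chain p Y (chain_map p f c)"
      by (rule singular_chain_chain_map[OF c f])
    have "chain_map p g c = ?a + (?b + chain_map p f c)"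
      using K[OF c] by (simp add: algebra_simps)
    then have "\<phi> (chain_map p g c) = \<phi> ?a \<oplus> (\<phi> ?b \<oplus> \<phi> (chain_map p f c))"
      by (simp only: \<phi>add a b fc singular_chain_add)
    then show ?thesis
      using \<phi>b[OF Kch[OF c]] \<phi>R b fc by simp
  qed
  interpret B: normal "coboundaries G p X" "cocycle_group G p X"
    by (rule normal_coboundaries)
  have fZ: "cochain_map p X f \<phi> \<in> carrier (cocycle_group G p X)"
    by (rule hom_in_carrier[OF cochain_map_hom[OF f] \<phi>])
  \<comment> \<open>In degree \<open>0\<close> the boundary of \<open>c\<close> is \<open>0\<close> and the difference is the zero cochain, which is
    the only coboundary there.\<close>
  obtain \<beta> where \<beta>: "\<beta> \<in> coboundaries G p X"
    "\<And>c. singular_chain p X c \<Longrightarrow> \<beta> c = \<phi> (K (p - 1) (chain_boundary p c))"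
  proof (cases p)
    case 0
    show thesis
      by (rule that[of "\<one>\<^bsub>cochain_group G 0 X\<^esub>"])
         (auto simp: 0 coboundaries_def chain_boundary_def K0 cochain_zero[OF \<phi>C[unfolded 0]])
  next
    case (Suc q)
    let ?\<psi> = "\<lambda>c\<in>singular_chain_set q X. \<phi> (K q c)"
    have "?\<psi> \<in> carrier (cochain_group G q X)"
      using Kch[of q] by (auto simp: mem_cochain_group Kadd singular_chain_add \<phi>R \<phi>add Suc)
    then have "coboundary_map q X ?\<psi> \<in> coboundaries G p X"
      by (simp add: coboundaries_def Suc)
    then show thesis
      by (rule that) (auto simp: Suc coboundary_map_def singular_chain_boundary_alt)
  qed
  have "cochain_map p X g \<phi> = \<beta> \<otimes>\<^bsub>cocycle_group G p X\<^esub> cochain_map p X f \<phi>"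
    using diff by (auto simp: cochain_map_def \<beta>(2))
  then have "cochain_map p X g \<phi> \<in> coboundaries G p X #>\<^bsub>cocycle_group G p X\<^esub> cochain_map p X f \<phi>"
    using \<beta>(1) by (auto simp: r_coset_def)
  then show ?thesis
    by (rule B.repr_independence[OF _ fZ B.subgroup_axioms])
qed

lemma carrier_total_cohomology:
  "x \<in> carrier (total_cohomology G X) \<longleftrightarrow>
     (\<forall>p. x p \<in> carrier (cohomology_group G p X)) \<and>
     finite {p. x p \<noteq> \<one>\<^bsub>cohomology_group G p X\<^esub>}"
  by (auto simp: total_cohomology_def carrier_sum_group group_cohomology_group PiE_iff)

lemma group_total_cohomology: "group (total_cohomology G X)"
  by (simp add: total_cohomology_def group_cohomology_group)

lemma total_cohom_induced_hom:
  assumes "continuous_map X Y f"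
  shows "total_cohom_induced G X f \<in> hom (total_cohomology G Y) (total_cohomology G X)"
  using sum_group_hom[of UNIV "\<lambda>p. cohomology_group G p Y" "\<lambda>p. cohomology_group G p X"
      "\<lambda>p. cohom_induced G p X f"]
  by (simp add: total_cohomology_def total_cohom_induced_def[abs_def] group_cohomology_group
      cohom_induced_hom[OF assms] restrict_UNIV)

lemma subgroup_induced_image:
  assumes "continuous_map X Y f"
  shows "subgroup (induced_image G X Y f) (total_cohomology G X)"
proof -
  interpret group_hom "total_cohomology G Y" "total_cohomology G X" "total_cohom_induced G X f"
    by (simp add: group_hom_def group_hom_axioms_def total_cohom_induced_hom[OF assms]
        group_total_cohomology)
  show ?thesis
    unfolding induced_image_def by (rule img_is_subgroup)
qed

lemma induced_image_homotopic:
  assumes "homotopic_with (\<lambda>_. True) X Y f g"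
  shows "induced_image G X Y f = induced_image G X Y g"
proof -
  have "cohom_induced G p X f K = cohom_induced G p X g K"
    if "K \<in> carrier (cohomology_group G p Y)" for p K
    using coset_subset_cocycles[OF that] homotopic_imp_cohomologous[OF assms]
    unfolding cohom_induced_def by (intro SUP_cong) auto
  then show ?thesis
    unfolding induced_image_def total_cohom_induced_def
    by (intro image_cong) (auto simp: carrier_total_cohomology)
qed

text \<open>Functoriality is the source of monotonicity: since \<open>(s \<circ> g)\<^sup>* = g\<^sup>* \<circ> s\<^sup>*\<close>, composing with
  \<open>s\<close> only shrinks the set to which \<open>g\<^sup>*\<close> is applied.\<close>

lemma induced_image_compose:
  assumes g: "continuous_map X Y g" and s: "continuous_map Y Z s"
  shows "induced_image G X Z (s \<circ> g) \<subseteq> induced_image G X Y g"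
proof -
  have "total_cohom_induced G X (s \<circ> g) x = total_cohom_induced G X g (total_cohom_induced G Y s x)"
    if "x \<in> carrier (total_cohomology G Z)" for x
    using that by (auto simp: total_cohom_induced_def carrier_total_cohomology cohom_induced_compose[OF g s])
  then show ?thesis
    unfolding induced_image_def using hom_in_carrier[OF total_cohom_induced_hom[OF s]] by auto
qed

end

section \<open>The order on homotopy classes and the image maps\<close>

lemma mem_homotopy_class:
  "g \<in> homotopy_class X Y f \<longleftrightarrow> homotopic_with (\<lambda>_. True) X Y f g"
  by (simp add: homotopy_class_def homotopy_rel_def)

lemma mem_homotopy_classes:
  "a \<in> homotopy_classes X Y \<longleftrightarrow> (\<exists>f. continuous_map X Y f \<and> a = homotopy_class X Y f)"
  by (auto simp: homotopy_classes_def quotient_def homotopy_class_def)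

lemma homotopy_class_eq:
  "homotopic_with (\<lambda>_. True) X Y f g \<Longrightarrow> homotopy_class X Y f = homotopy_class X Y g"
  by (auto simp: mem_homotopy_class)
     (blast intro: homotopic_with_trans homotopic_with_symD)+

text \<open>Homotopic factors have homotopic composites, so all classes in the union that defines
  composition coincide.\<close>

lemma hcomp_homotopy_class:
  assumes "continuous_map X Y f" "continuous_map Y Z t"
  shows "hcomp X Y Z (homotopy_class Y Z t) (homotopy_class X Y f) = homotopy_class X Z (t \<circ> f)"
proof -
  have "homotopy_class X Z (s \<circ> g) = homotopy_class X Z (t \<circ> f)"
    if "s \<in> homotopy_class Y Z t" "g \<in> homotopy_class X Y f" for s g
    using that homotopic_compose[of X Y f g Z t s]
    by (metis homotopy_class_eq mem_homotopy_class)
  moreover have "f \<in> homotopy_class X Y f" "t \<in> homotopy_class Y Z t"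
    using assms by (simp_all add: mem_homotopy_class)
  ultimately show ?thesis
    unfolding hcomp_def by blast
qed

lemma leL_homotopy_class:
  assumes "continuous_map X Y g"
  shows "leL X Y a (homotopy_class X Y g) \<longleftrightarrow>
           (\<exists>t. continuous_map Y Y t \<and> a = homotopy_class X Y (t \<circ> g))"
proof -
  have "hcomp X Y Y (homotopy_class Y Y t) (homotopy_class X Y g) = homotopy_class X Y (t \<circ> g)"
    if "continuous_map Y Y t" for t
    using assms that by (rule hcomp_homotopy_class)
  then show ?thesis
    by (fastforce simp: leL_def mem_homotopy_classes)
qed

lemma leL_refl: "a \<in> homotopy_classes X Y \<Longrightarrow> leL X Y a a"
  by (auto simp: mem_homotopy_classes leL_homotopy_class intro!: exI[of _ id])

context abelian_group
begin

lemma Im_H_homotopy_class: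
  assumes "continuous_map X Y f"
  shows "Im_H G X Y (homotopy_class X Y f) = induced_image G X Y f"
  unfolding Im_H_def
proof (rule the_elem_image_unique)
  show "homotopy_class X Y f \<noteq> {}"
    using assms mem_homotopy_class[of f X Y f] by auto
  show "induced_image G X Y g = induced_image G X Y f" if "g \<in> homotopy_class X Y f" for g
    using that induced_image_homotopic by (metis mem_homotopy_class)
qed

lemma Im_H_mono:
  assumes "b \<in> homotopy_classes X Y" "leL X Y a b"
  shows "Im_H G X Y a \<subseteq> Im_H G X Y b"
proof -
  obtain g where g: "continuous_map X Y g" "b = homotopy_class X Y g"
    using assms by (auto simp: mem_homotopy_classes)
  then obtain t where t: "continuous_map Y Y t" "a = homotopy_class X Y (t \<circ> g)"
    using assms by (auto simp: leL_homotopy_class)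
  show ?thesis
    using induced_image_compose[OF g(1) t(1)]
    by (simp add: g t Im_H_homotopy_class continuous_map_compose[OF g(1) t(1)])
qed

lemma Im_H_simL: "(a, b) \<in> simL X Y \<Longrightarrow> Im_H G X Y a = Im_H G X Y b"
  by (auto simp: simL_def dest: Im_H_mono)

lemma Im_H'_piL:
  assumes "a \<in> homotopy_classes X Y"
  shows "Im_H' G X Y (piL X Y a) = Im_H G X Y a"
  unfolding Im_H'_def
proof (rule the_elem_image_unique)
  show "piL X Y a \<noteq> {}"
    using assms leL_refl by (auto simp: piL_def simL_def)
qed (auto simp: piL_def dest: Im_H_simL)

lemma Im_H_in_Sub: "a \<in> homotopy_classes X Y \<Longrightarrow> Im_H G X Y a \<in> Sub (total_cohomology G X)"
  by (auto simp: mem_homotopy_classes Im_H_homotopy_class Sub_def subgroup_induced_image)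

lemma mem_classesL: "A \<in> classesL X Y \<longleftrightarrow> (\<exists>a\<in>homotopy_classes X Y. A = piL X Y a)"
  by (auto simp: classesL_def quotient_def piL_def)

lemma Im_H'_mono:
  assumes A: "A \<in> classesL X Y" and B: "B \<in> classesL X Y" and le: "leL' X Y A B"
  shows "Im_H' G X Y A \<subseteq> Im_H' G X Y B"
proof -
  obtain a b where ab: "a \<in> homotopy_classes X Y" "A = piL X Y a"
    "b \<in> homotopy_classes X Y" "B = piL X Y b"
    using A B by (auto simp: mem_classesL)
  obtain a' b' where le': "(a, a') \<in> simL X Y" "(b, b') \<in> simL X Y" "leL X Y a' b'"
    using le by (auto simp: leL'_def ab piL_def)
  then have "Im_H G X Y a' \<subseteq> Im_H G X Y b'"
    by (intro Im_H_mono) (auto simp: simL_def)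
  then show ?thesis
    using Im_H_simL[OF le'(1)] Im_H_simL[OF le'(2)] by (simp add: ab Im_H'_piL)
qed

end

theorem lemma4p3:
  fixes X :: "'a topology" and Y :: "'b topology" and R :: "('r, 'm) ring_scheme"
  assumes "ring R"
  shows
    "induced_image R X Y respects homotopy_rel X Y
     \<and> (\<forall>f. continuous_map X Y f \<longrightarrow>
          Im_H R X Y (homotopy_class X Y f)
            = total_cohom_induced R X f ` carrier (total_cohomology R Y))
     \<and> Im_H R X Y \<in> homotopy_classes X Y \<rightarrow> Sub (total_cohomology R X)
     \<and> monotone_on (homotopy_classes X Y) (leL X Y) (\<subseteq>) (Im_H R X Y)
     \<and> Im_H R X Y respects simL X Y
     \<and> (\<forall>f. continuous_map X Y f \<longrightarrow>
          Im_H' R X Y (piL X Y (homotopy_class X Y f)) = Im_H R X Y (homotopy_class X Y f))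
     \<and> Im_H' R X Y \<in> classesL X Y \<rightarrow> Sub (total_cohomology R X)
     \<and> monotone_on (classesL X Y) (leL' X Y) (\<subseteq>) (Im_H' R X Y)
     \<and> (\<forall>a \<in> homotopy_classes X Y. (Im_H' R X Y \<circ> piL X Y) a = Im_H R X Y a)"
proof -
  interpret ring R by fact
  show ?thesis
  proof (intro conjI allI impI ballI Pi_I monotone_onI)
    show "induced_image R X Y respects homotopy_rel X Y"
      by (auto simp: congruent_def homotopy_rel_def induced_image_homotopic)
    show "Im_H R X Y respects simL X Y"
      by (auto simp: congruent_def Im_H_simL)
    show "Im_H R X Y (homotopy_class X Y f)
            = total_cohom_induced R X f ` carrier (total_cohomology R Y)"
      if "continuous_map X Y f" for f
      using Im_H_homotopy_class[OF that] by (simp add: induced_image_def)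
    show "Im_H' R X Y (piL X Y (homotopy_class X Y f)) = Im_H R X Y (homotopy_class X Y f)"
      if "continuous_map X Y f" for f
      using that by (intro Im_H'_piL) (auto simp: mem_homotopy_classes)
    show "Im_H' R X Y A \<in> Sub (total_cohomology R X)" if "A \<in> classesL X Y" for A
      using that by (auto simp: mem_classesL Im_H'_piL Im_H_in_Sub)
  qed (simp_all add: Im_H_in_Sub Im_H_mono Im_H'_mono Im_H'_piL)
qed

end
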